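(* Let $H\in\mathbb{C}^{n\times n}$ be an invertible Hermitian matrix and let $B\in\mathbb{C}^{n\times n}$ be an $H$-nonnegative matrix. Then $B$ has an $H$-nonnegative square root if and only if the following properties hold: (i) $B$ has no negative eigenvalues, that is, $\sigma(B)\subset[0,\infty)$; (ii) $B$ has no Jordan blocks of size two at the eigenvalue zero.
   Context: With $(\cdot,\cdot)$ the Euclidean inner product on $\mathbb{C}^n$ and $[x,y]=(Hx,y)$, a matrix $B\in\mathbb{C}^{n\times n}$ is $H$-nonnegative if $[Bx,x]\ge 0$ for all $x\in\mathbb{C}^n$. An $H$-nonnegative square root of $B$ is an $H$-nonnegative matrix $A\in\mathbb{C}^{n\times n}$ with $A^2=B$. (The Jordan blocks at $0$ of an $H$-nonnegative matrix have size at most two.) *)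

theory Defs
  imports
    "Jordan_Normal_Form.Schur_Decomposition"
    "Jordan_Normal_Form.Spectral_Radius"
    "HOL-Library.Nonpos_Ints"
begin

definition hermitian_mat :: "complex mat \<Rightarrow> bool" where
  "hermitian_mat H \<longleftrightarrow> square_mat H \<and> mat_adjoint H = H"

definition indef_prod :: "complex mat \<Rightarrow> complex vec \<Rightarrow> complex vec \<Rightarrow> complex" where
  "indef_prod H x y = (H *\<^sub>v x) \<bullet>c y"

text \<open>The order on the complex numbers is the one of \<^theory>\<open>HOL-Library.Complex_Order\<close>:
  \<^prop>\<open>0 \<le> (z :: complex)\<close> says that \<^term>\<open>z\<close> is real and nonnegative.\<close>

definition H_nonnegative :: "nat \<Rightarrow> complex mat \<Rightarrow> complex mat \<Rightarrow> bool" where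
  "H_nonnegative n H B \<longleftrightarrow>
     B \<in> carrier_mat n n \<and> (\<forall>x \<in> carrier_vec n. 0 \<le> indef_prod H (B *\<^sub>v x) x)"

definition H_nonnegative_sqrt :: "nat \<Rightarrow> complex mat \<Rightarrow> complex mat \<Rightarrow> complex mat \<Rightarrow> bool" where
  "H_nonnegative_sqrt n H B A \<longleftrightarrow> H_nonnegative n H A \<and> A * A = B"

text \<open>The Jordan normal form is unique up to the order of its blocks
  (\<open>jordan_nf_unique\<close>), so it does not matter which one the existential quantifier picks.\<close>

definition has_jordan_block :: "complex mat \<Rightarrow> nat \<Rightarrow> complex \<Rightarrow> bool" where
  "has_jordan_block B k a \<longleftrightarrow> (\<exists>n_as. jordan_nf B n_as \<and> (k, a) \<in> set n_as)"

end

theory Submission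
  imports Defs "Jordan_Normal_Form.Jordan_Normal_Form_Uniqueness"
begin

text \<open>
  Write \<open>\<langle>x, y\<rangle>\<close> for the indefinite form \<open>(H x, y)\<close>. Two consequences of nonnegativity of a matrix
  \<open>A\<close> carry everything: \<open>A\<close> is selfadjoint for the form, and \<open>\<langle>A x, x\<rangle> = 0\<close> forces \<open>A x = 0\<close>. Both hold
  because \<open>H A\<close> is positive semidefinite and \<open>H\<close> is injective. They imply that the eigenvalues of
  \<open>A\<close> are real, that \<open>A\<^sup>3 x = 0\<close> implies \<open>A\<^sup>2 x = 0\<close>, and that \<open>(A - a)\<^sup>2 x = 0\<close> implies \<open>(A - a) x = 0\<close>
  for real \<open>a \<noteq> 0\<close>. The link from such kernel equations to Jordan blocks is
  \<open>jordan_block_size_le\<close>: if the kernels of \<open>(A - a)\<^sup>k\<close> and \<open>(A - a)\<^bsup>k+1\<^esup>\<close> agree, then no block at \<open>a\<close>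
  is larger than \<open>k\<close>.

  If \<open>B = A\<^sup>2\<close> with \<open>A\<close> nonnegative, then every eigenvalue of \<open>B\<close> is the square of an eigenvalue of
  \<open>A\<close>, hence of a real number; and \<open>B\<^sup>2 x = A\<^sup>4 x = 0\<close> gives \<open>B x = A\<^sup>2 x = 0\<close>, so that the blocks
  of \<open>B\<close> at \<open>0\<close> have size one.

  Conversely, the two conditions make \<open>B\<close> diagonalizable, \<open>B = P D P\<^sup>-\<^sup>1\<close> with \<open>D \<ge> 0\<close>, and
  \<open>A = P D\<^bsup>1/2\<^esup> P\<^sup>-\<^sup>1\<close> is a square root of \<open>B\<close>. Its nonnegativity comes from the
  factorization \<open>A = W B W\<close> with \<open>W = P D\<^bsup>-1/4\<^esup> P\<^sup>-\<^sup>1\<close>, where \<open>0\<close> stands for the power of an eigenvalue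
  \<open>0\<close>. As a real function of \<open>B\<close>, the matrix \<open>W\<close> is again selfadjoint for the form
  (\<open>H_selfadjoint_function\<close>), and therefore \<open>\<langle>A x, x\<rangle> = \<langle>B (W x), W x\<rangle> \<ge> 0\<close>.
\<close>

section \<open>Positive semidefinite forms\<close>

lemma cscalar_prod_quadratic_expansion:
  fixes M :: "complex mat"
  assumes "M \<in> carrier_mat n n" "x \<in> carrier_vec n" "y \<in> carrier_vec n"
  shows "(M *\<^sub>v (x + c \<cdot>\<^sub>v y)) \<bullet>c (x + c \<cdot>\<^sub>v y) =
    (M *\<^sub>v x) \<bullet>c x + cnj c * ((M *\<^sub>v x) \<bullet>c y) + c * ((M *\<^sub>v y) \<bullet>c x)
      + c * cnj c * ((M *\<^sub>v y) \<bullet>c y)"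
  using assms
  by (simp add: mult_add_distrib_mat_vec[of _ n n] mult_mat_vec[of _ n n]
      conjugate_add_vec[of _ n] conjugate_smult_vec add_scalar_prod_distrib[of _ n]
      scalar_prod_add_distrib[of _ n] smult_scalar_prod_distrib[of _ n]
      scalar_prod_smult_distrib[of _ n] algebra_simps)

text \<open>Polarization: the values of the form at \<open>x + y\<close> and at \<open>x + \<i> y\<close> are real, so that the
  imaginary part of \<open>(M x, y) + (M y, x)\<close> and the real part of \<open>(M x, y) - (M y, x)\<close> vanish.\<close>

lemma psd_hermitian_form:
  fixes M :: "complex mat"
  assumes M: "M \<in> carrier_mat n n"
    and psd: "\<And>x. x \<in> carrier_vec n \<Longrightarrow> 0 \<le> (M *\<^sub>v x) \<bullet>c x"
    and x: "x \<in> carrier_vec n" and y: "y \<in> carrier_vec n"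
  shows "(M *\<^sub>v x) \<bullet>c y = cnj ((M *\<^sub>v y) \<bullet>c x)"
proof -
  let ?a = "(M *\<^sub>v x) \<bullet>c y" and ?b = "(M *\<^sub>v y) \<bullet>c x"
  have im: "Im ((M *\<^sub>v z) \<bullet>c z) = 0" if "z \<in> carrier_vec n" for z
    using psd[OF that] by (simp add: less_eq_complex_def)
  have "Im (cnj c * ?a + c * ?b) = 0" for c
  proof -
    have "x + c \<cdot>\<^sub>v y \<in> carrier_vec n" using x y by simp
    from im[OF this] show ?thesis
      unfolding cscalar_prod_quadratic_expansion[OF M x y] using im[OF x] im[OF y] by simp
  qed
  from this[of 1] this[of \<i>] show ?thesis by (simp add: complex_eq_iff)
qed

text \<open>Along the line from \<open>x\<close> in the direction \<open>y = M x\<close> the form has the linear term \<open>2 t \<parallel>y\<parallel>\<^sup>2\<close> and no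
  constant term, so it would become negative for small negative \<open>t\<close> unless \<open>y = 0\<close>.\<close>

lemma psd_isotropic_imp_kernel:
  fixes M :: "complex mat"
  assumes M: "M \<in> carrier_mat n n"
    and psd: "\<And>x. x \<in> carrier_vec n \<Longrightarrow> 0 \<le> (M *\<^sub>v x) \<bullet>c x"
    and x: "x \<in> carrier_vec n" and 0: "(M *\<^sub>v x) \<bullet>c x = 0"
  shows "M *\<^sub>v x = 0\<^sub>v n"
proof (rule ccontr)
  assume neq: "M *\<^sub>v x \<noteq> 0\<^sub>v n"
  define y where "y = M *\<^sub>v x"
  have y: "y \<in> carrier_vec n" using M x unfolding y_def by simp
  define q r where "q = Re (y \<bullet>c y)" and "r = Re ((M *\<^sub>v y) \<bullet>c y)"
  have "0 < y \<bullet>c y" using neq y by (simp add: y_def)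
  hence q: "q > 0" and yy: "y \<bullet>c y = of_real q"
    by (auto simp: q_def less_complex_def complex_eq_iff)
  have r: "r \<ge> 0" using psd[OF y] by (simp add: r_def less_eq_complex_def)
  have xy: "(M *\<^sub>v y) \<bullet>c x = of_real q"
    using psd_hermitian_form[OF M psd y x] yy by (simp add: y_def[symmetric])
  (* The real quadratic r t^2 + 2 q t is negative at t = -s; dividing by r + 1 rather than r
     keeps this true when r = 0. *)
  define s where "s = q / (r + 1)"
  have s: "s > 0" and q_s: "q = s * (r + 1)" using q r by (simp_all add: s_def)
  have "x + of_real (- s) \<cdot>\<^sub>v y \<in> carrier_vec n" using x y by simp
  from psd[OF this] have "0 \<le> s * s * r - 2 * s * q"
    unfolding cscalar_prod_quadratic_expansion[OF M x y] xy y_def[symmetric] yy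
    using 0[folded y_def] by (simp add: less_eq_complex_def r_def algebra_simps)
  also have "\<dots> = - (s * s * (r + 2))" unfolding q_s by (simp add: algebra_simps)
  also have "\<dots> < 0" using s r by simp
  finally show False by simp
qed

lemma mat_adjoint_dim [simp]: "dim_row (mat_adjoint M) = dim_col M" "dim_col (mat_adjoint M) = dim_row M"
  by (simp_all add: mat_adjoint_def)

lemma mat_adjoint_index [simp]:
  "i < dim_col M \<Longrightarrow> j < dim_row M \<Longrightarrow> mat_adjoint M $$ (i, j) = conjugate (M $$ (j, i))"
  by (simp add: mat_adjoint_def mat_of_rows_def)

lemma cscalar_prod_mat_adjoint:
  fixes M :: "complex mat"
  assumes M: "M \<in> carrier_mat n n" and x: "x \<in> carrier_vec n" and y: "y \<in> carrier_vec n"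
  shows "(M *\<^sub>v x) \<bullet>c y = x \<bullet>c (mat_adjoint M *\<^sub>v y)"
proof -
  have "x \<bullet>c (mat_adjoint M *\<^sub>v y) = (\<Sum>j<n. x $ j * (\<Sum>i<n. M $$ (i, j) * cnj (y $ i)))"
    using assms by (auto simp: scalar_prod_def atLeast0LessThan intro!: sum.cong)
  also have "\<dots> = (\<Sum>i<n. (\<Sum>j<n. M $$ (i, j) * x $ j) * cnj (y $ i))"
    unfolding sum_distrib_left sum_distrib_right
    by (subst sum.swap) (simp add: ac_simps)
  also have "\<dots> = (M *\<^sub>v x) \<bullet>c y"
    using assms by (auto simp: scalar_prod_def atLeast0LessThan intro!: sum.cong)
  finally show ?thesis ..
qed

section \<open>Kernels and sizes of Jordan blocks\<close>

lemma char_matrix_mult_vec: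
  fixes A :: "'a :: field mat"
  assumes "A \<in> carrier_mat n n" "v \<in> carrier_vec n"
  shows "char_matrix A a *\<^sub>v v = A *\<^sub>v v - a \<cdot>\<^sub>v v"
  unfolding char_matrix_def using assms
  by (intro eq_vecI) (auto simp: add_scalar_prod_distrib[of _ n])

lemma char_matrix_0:
  fixes A :: "'a :: field mat"
  assumes "A \<in> carrier_mat n n"
  shows "char_matrix A 0 = A"
  using assms by (intro eq_matI) (auto simp: char_matrix_def)

lemma pow_mat_Suc_left:
  fixes A :: "'a :: semiring_1 mat"
  assumes "A \<in> carrier_mat n n"
  shows "A ^\<^sub>m Suc k = A * A ^\<^sub>m k"
  using assms
proof (induct k)
  case (Suc k)
  thus ?case using assoc_mult_mat[of A n n "A ^\<^sub>m k" n A n] by auto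
qed auto

lemma pow_mat_Suc_mult_vec:
  fixes A :: "'a :: semiring_1 mat"
  assumes A: "A \<in> carrier_mat n n" and v: "v \<in> carrier_vec n"
  shows "A ^\<^sub>m Suc k *\<^sub>v v = A *\<^sub>v (A ^\<^sub>m k *\<^sub>v v)"
  unfolding pow_mat_Suc_left[OF A] by (rule assoc_mult_mat_vec[OF A pow_carrier_mat[OF A] v])

lemma pow_mat_0_mult_vec:
  fixes A :: "'a :: semiring_1 mat"
  assumes "A \<in> carrier_mat n n" "v \<in> carrier_vec n"
  shows "A ^\<^sub>m 0 *\<^sub>v v = v"
  using assms by simp

text \<open>The kernel of the \<open>k\<close>-th power of \<open>A - a\<close> has dimension \<open>\<Sum> min k s\<close>, taken over the sizes
  \<open>s\<close> of the blocks at \<open>a\<close>. A block larger than \<open>k\<close> makes this sum grow from \<open>k\<close> to \<open>k + 1\<close>.\<close>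

lemma jordan_block_size_le:
  fixes A :: "'a :: field mat"
  assumes A: "A \<in> carrier_mat n n" and jnf: "jordan_nf A n_as"
    and stable: "\<And>v. v \<in> carrier_vec n \<Longrightarrow> char_matrix A a ^\<^sub>m Suc k *\<^sub>v v = 0\<^sub>v n \<Longrightarrow>
      char_matrix A a ^\<^sub>m k *\<^sub>v v = 0\<^sub>v n"
    and mem: "(m, a) \<in> set n_as"
  shows "m \<le> k"
proof (rule ccontr)
  assume "\<not> m \<le> k"
  let ?C = "char_matrix A a"
  have C: "?C \<in> carrier_mat n n" and Ck: "?C ^\<^sub>m k \<in> carrier_mat n n"
    and CSk: "?C ^\<^sub>m Suc k \<in> carrier_mat n n" using char_matrix_closed[OF A] pow_carrier_mat by blast+
  have "mat_kernel (?C ^\<^sub>m k) \<subseteq> mat_kernel (?C ^\<^sub>m Suc k)"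
    unfolding pow_mat_Suc_left[OF C] by (rule mat_kernel_mult_subset[OF Ck C])
  moreover have "mat_kernel (?C ^\<^sub>m Suc k) \<subseteq> mat_kernel (?C ^\<^sub>m k)"
    unfolding mat_kernel[OF Ck] mat_kernel[OF CSk] using stable by blast
  ultimately have ker: "mat_kernel (?C ^\<^sub>m Suc k) = mat_kernel (?C ^\<^sub>m k)" by blast
  have dc: "dim_col (?C ^\<^sub>m Suc k) = dim_col (?C ^\<^sub>m k)"
    using carrier_matD(2)[OF Ck] carrier_matD(2)[OF CSk] by simp
  have "dim_gen_eigenspace A a (Suc k) = dim_gen_eigenspace A a k"
    unfolding dim_gen_eigenspace_def kernel_dim_def ker dc ..
  moreover have "(\<Sum>s\<leftarrow>xs. min k s) < (\<Sum>s\<leftarrow>xs. min (Suc k) s)" if "m \<in> set xs" for xs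
    using that
  proof (induct xs)
    case (Cons s xs)
    have "(\<Sum>s\<leftarrow>xs. min k s) \<le> (\<Sum>s\<leftarrow>xs. min (Suc k) s)" by (rule sum_list_mono) auto
    with Cons \<open>\<not> m \<le> k\<close> show ?case by (cases "m = s") (auto simp: add_le_less_mono add_less_le_mono)
  qed simp
  moreover have "m \<in> set (map fst [(n, e)\<leftarrow>n_as . e = a])" using mem by force
  ultimately show False unfolding dim_gen_eigenspace[OF jnf] by fastforce
qed

lemma mat_diag_mult_vec:
  fixes u :: "'a :: comm_ring_1 vec"
  assumes u: "u \<in> carrier_vec n"
  shows "mat_diag n g *\<^sub>v u = vec n (\<lambda>i. g i * u $ i)"
proof (intro eq_vecI)
  fix i assume "i < dim_vec (vec n (\<lambda>i. g i * u $ i))"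
  hence i: "i < n" by simp
  have "(mat_diag n g *\<^sub>v u) $ i = (\<Sum>j<n. (if i = j then g j else 0) * u $ j)"
    using i u by (auto simp: mat_diag_def scalar_prod_def atLeast0LessThan intro!: sum.cong)
  also have "\<dots> = (\<Sum>j<n. if i = j then g j * u $ j else 0)" by (intro sum.cong) auto
  finally show "(mat_diag n g *\<^sub>v u) $ i = vec n (\<lambda>i. g i * u $ i) $ i" using i by simp
qed (simp add: mat_diag_def)

lemma jordan_matrix_diagonal:
  assumes "\<And>m a. (m, a) \<in> set n_as \<Longrightarrow> m = 1"
  shows "jordan_matrix n_as = mat_diag (length n_as) (\<lambda>i. snd (n_as ! i))"
  using assms
proof (induct n_as)
  case Nil
  show ?case by (rule eq_matI) (auto simp: mat_diag_def)
next
  case (Cons ma n_as)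
  obtain a where ma: "ma = (1, a)" using Cons(2) by (cases ma) auto
  have "map fst n_as = map (\<lambda>_. 1) n_as"
    by (rule map_cong) (use Cons(2) in fastforce)+
  hence "sum_list (map fst n_as) = length n_as" by (simp only: sum_list_triv) simp
  moreover have "jordan_matrix n_as = mat_diag (length n_as) (\<lambda>i. snd (n_as ! i))"
    using Cons(1) Cons(2) by auto
  ultimately show ?case unfolding ma jordan_matrix_Cons
    by (intro eq_matI) (auto simp: mat_diag_def nth_Cons')
qed

section \<open>Matrices that are nonnegative for an indefinite form\<close>

definition H_selfadjoint :: "nat \<Rightarrow> complex mat \<Rightarrow> complex mat \<Rightarrow> bool" where
  "H_selfadjoint n H W \<longleftrightarrow> W \<in> carrier_mat n n \<and>
     (\<forall>x \<in> carrier_vec n. \<forall>y \<in> carrier_vec n. indef_prod H (W *\<^sub>v x) y = indef_prod H x (W *\<^sub>v y))"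

locale indefinite_space =
  fixes n :: nat and H :: "complex mat"
  assumes H: "H \<in> carrier_mat n n"
    and invertible: "invertible_mat H"
    and hermitian: "hermitian_mat H"
begin

abbreviation ip :: "complex vec \<Rightarrow> complex vec \<Rightarrow> complex" ("\<langle>_, _\<rangle>") where
  "\<langle>x, y\<rangle> \<equiv> indef_prod H x y"

lemma ip_smult_left: "x \<in> carrier_vec n \<Longrightarrow> y \<in> carrier_vec n \<Longrightarrow> \<langle>c \<cdot>\<^sub>v x, y\<rangle> = c * \<langle>x, y\<rangle>"
  using H by (simp add: indef_prod_def mult_mat_vec[of _ n n] smult_scalar_prod_distrib[of _ n])

lemma ip_smult_right: "x \<in> carrier_vec n \<Longrightarrow> y \<in> carrier_vec n \<Longrightarrow> \<langle>x, c \<cdot>\<^sub>v y\<rangle> = cnj c * \<langle>x, y\<rangle>"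
  using H by (simp add: indef_prod_def conjugate_smult_vec scalar_prod_smult_distrib[of _ n])

lemma ip_diff_left:
  "x \<in> carrier_vec n \<Longrightarrow> y \<in> carrier_vec n \<Longrightarrow> z \<in> carrier_vec n \<Longrightarrow>
   \<langle>x - y, z\<rangle> = \<langle>x, z\<rangle> - \<langle>y, z\<rangle>"
  using H by (simp add: indef_prod_def mult_minus_distrib_mat_vec[of _ n n]
      minus_scalar_prod_distrib[of _ n])

lemma ip_zero_left: "y \<in> carrier_vec n \<Longrightarrow> \<langle>0\<^sub>v n, y\<rangle> = 0"
proof -
  assume y: "y \<in> carrier_vec n"
  have "0 \<cdot>\<^sub>v y = 0\<^sub>v n" using y by (intro eq_vecI) auto
  thus ?thesis using ip_smult_left[OF y y, of 0] by simp
qed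

lemma ip_flip:
  assumes "x \<in> carrier_vec n" "y \<in> carrier_vec n"
  shows "\<langle>x, y\<rangle> = x \<bullet>c (H *\<^sub>v y)"
  using cscalar_prod_mat_adjoint[OF H assms] hermitian by (simp add: indef_prod_def hermitian_mat_def)

lemma H_kernel:
  assumes "v \<in> carrier_vec n" and "H *\<^sub>v v = 0\<^sub>v n"
  shows "v = 0\<^sub>v n"
proof -
  from invertible obtain K where K: "H * K = 1\<^sub>m n" "K * H = 1\<^sub>m (dim_row K)"
    using H unfolding invertible_mat_def inverts_mat_def by auto
  have "dim_col (H * K) = n" "dim_col (K * H) = dim_row K" by (simp_all add: K)
  hence Kc: "K \<in> carrier_mat n n" using H by auto
  have "v = (K * H) *\<^sub>v v" using K Kc assms by simp
  also have "\<dots> = K *\<^sub>v (H *\<^sub>v v)" using Kc H assms by simp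
  also have "\<dots> = 0\<^sub>v n" using assms Kc by auto
  finally show ?thesis .
qed

lemma H_nonnegative_selfadjoint:
  assumes "H_nonnegative n H A"
  shows "H_selfadjoint n H A"
proof -
  have A: "A \<in> carrier_mat n n"
    and nonneg: "\<And>x. x \<in> carrier_vec n \<Longrightarrow> 0 \<le> (H * A *\<^sub>v x) \<bullet>c x"
    using assms H by (auto simp: H_nonnegative_def indef_prod_def)
  have HA: "H * A \<in> carrier_mat n n" using H A by simp
  have "\<langle>A *\<^sub>v x, y\<rangle> = \<langle>x, A *\<^sub>v y\<rangle>" if x: "x \<in> carrier_vec n" and y: "y \<in> carrier_vec n" for x y
  proof -
    have v: "A *\<^sub>v y \<in> carrier_vec n" using A y by simp
    have "\<langle>A *\<^sub>v x, y\<rangle> = (H * A *\<^sub>v x) \<bullet>c y" using H A x by (simp add: indef_prod_def)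
    also have "\<dots> = cnj ((H * A *\<^sub>v y) \<bullet>c x)" by (rule psd_hermitian_form[OF HA nonneg x y])
    also have "\<dots> = x \<bullet>c (H * A *\<^sub>v y)"
      using conjugate_conjugate_sprod[of x n "H * A *\<^sub>v y"]
      using H A x y by (simp add: conjugate_vec_sprod_comm[of _ n] conjugate_sprod_vec[of _ n])
    also have "\<dots> = \<langle>x, A *\<^sub>v y\<rangle>" using ip_flip[OF x v] H A y by simp
    finally show ?thesis .
  qed
  thus ?thesis using A by (simp add: H_selfadjoint_def)
qed

lemma H_nonnegative_isotropic:
  assumes "H_nonnegative n H A" and x: "x \<in> carrier_vec n" and 0: "\<langle>A *\<^sub>v x, x\<rangle> = 0"
  shows "A *\<^sub>v x = 0\<^sub>v n"
proof -
  have A: "A \<in> carrier_mat n n"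
    and nonneg: "\<And>x. x \<in> carrier_vec n \<Longrightarrow> 0 \<le> (H * A *\<^sub>v x) \<bullet>c x"
    using assms H by (auto simp: H_nonnegative_def indef_prod_def)
  have HA: "H * A \<in> carrier_mat n n" using H A by simp
  have "(H * A *\<^sub>v x) \<bullet>c x = 0" using 0 H A x by (simp add: indef_prod_def)
  from psd_isotropic_imp_kernel[OF HA nonneg x this] show ?thesis
    using H_kernel[of "A *\<^sub>v x"] H A x by simp
qed

text \<open>Selfadjointness only gives \<open>l = cnj l\<close> when the eigenvector \<open>x\<close> is not isotropic. If
  \<open>\<langle>x, x\<rangle> = 0\<close>, then \<open>\<langle>A x, x\<rangle> = l \<langle>x, x\<rangle> = 0\<close>, so \<open>A x = 0\<close> and the eigenvalue is \<open>0\<close>.\<close>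

lemma H_nonnegative_eigenvalue_real:
  assumes nn: "H_nonnegative n H A" and x: "x \<in> carrier_vec n" "x \<noteq> 0\<^sub>v n" and ev: "A *\<^sub>v x = l \<cdot>\<^sub>v x"
  shows "l \<in> \<real>"
proof (cases "\<langle>x, x\<rangle> = 0")
  case True
  hence "\<langle>A *\<^sub>v x, x\<rangle> = 0" unfolding ev using x by (simp add: ip_smult_left)
  from H_nonnegative_isotropic[OF nn x(1) this] have "l \<cdot>\<^sub>v x = 0\<^sub>v n" unfolding ev .
  moreover obtain i where "i < n" "x $ i \<noteq> 0" using x by (metis carrier_vecD eq_vecI index_zero_vec)
  ultimately have "l = 0" using x(1) by (metis carrier_vecD index_smult_vec(1) index_zero_vec(1) mult_eq_0_iff)
  thus ?thesis by simp
next
  case False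
  have "\<langle>A *\<^sub>v x, x\<rangle> = \<langle>x, A *\<^sub>v x\<rangle>"
    using H_nonnegative_selfadjoint[OF nn] x(1) by (simp add: H_selfadjoint_def)
  hence "l * \<langle>x, x\<rangle> = cnj l * \<langle>x, x\<rangle>" unfolding ev using x by (simp add: ip_smult_left ip_smult_right)
  with False show ?thesis by (simp add: Reals_cnj_iff)
qed

text \<open>Moving one factor across the form gives \<open>\<langle>A (A x), A x\<rangle> = \<langle>A\<^sup>3 x, x\<rangle> = 0\<close>.\<close>

lemma H_nonnegative_kernel_cube:
  assumes nn: "H_nonnegative n H A" and x: "x \<in> carrier_vec n"
    and 0: "A *\<^sub>v (A *\<^sub>v (A *\<^sub>v x)) = 0\<^sub>v n"
  shows "A *\<^sub>v (A *\<^sub>v x) = 0\<^sub>v n"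
proof -
  have A: "A \<in> carrier_mat n n" using nn by (simp add: H_nonnegative_def)
  have "\<langle>A *\<^sub>v (A *\<^sub>v x), A *\<^sub>v x\<rangle> = \<langle>A *\<^sub>v (A *\<^sub>v (A *\<^sub>v x)), x\<rangle>"
    using H_nonnegative_selfadjoint[OF nn] x A by (simp add: H_selfadjoint_def)
  also have "\<dots> = 0" unfolding 0 by (rule ip_zero_left[OF x])
  finally show ?thesis using H_nonnegative_isotropic[OF nn, of "A *\<^sub>v x"] A x by simp
qed

text \<open>Being an image under \<open>A - a\<close>, the vector \<open>y\<close> is orthogonal to the kernel of \<open>A - a\<close>, which contains
  \<open>y\<close> itself. So \<open>\<langle>A y, y\<rangle> = a \<langle>y, y\<rangle> = 0\<close> and \<open>a y = A y = 0\<close>. This is the step that excludes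
  generalized eigenvectors of higher rank at \<open>a \<noteq> 0\<close>.\<close>

lemma H_nonnegative_kernel_shift:
  assumes nn: "H_nonnegative n H A" and x: "x \<in> carrier_vec n"
    and a: "a \<in> \<real>" "a \<noteq> 0" and y_def: "y = A *\<^sub>v x - a \<cdot>\<^sub>v x" and ev: "A *\<^sub>v y = a \<cdot>\<^sub>v y"
  shows "y = 0\<^sub>v n"
proof -
  have A: "A \<in> carrier_mat n n" using nn by (simp add: H_nonnegative_def)
  have y: "y \<in> carrier_vec n" using A x unfolding y_def by simp
  have "\<langle>y, y\<rangle> = \<langle>A *\<^sub>v x, y\<rangle> - a * \<langle>x, y\<rangle>"
    using A x y by (subst (1) y_def) (simp add: ip_diff_left ip_smult_left)
  also have "\<langle>A *\<^sub>v x, y\<rangle> = \<langle>x, a \<cdot>\<^sub>v y\<rangle>"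
    using H_nonnegative_selfadjoint[OF nn] x y by (simp add: H_selfadjoint_def ev)
  also have "\<dots> = a * \<langle>x, y\<rangle>" using x y a by (simp add: ip_smult_right Reals_cnj_iff)
  finally have "\<langle>A *\<^sub>v y, y\<rangle> = 0" unfolding ev using y by (simp add: ip_smult_left)
  from H_nonnegative_isotropic[OF nn y this] have 0: "a \<cdot>\<^sub>v y = 0\<^sub>v n" unfolding ev .
  have "y = inverse a \<cdot>\<^sub>v (a \<cdot>\<^sub>v y)" using a by (simp add: smult_smult_assoc)
  also have "\<dots> = 0\<^sub>v n" unfolding 0 by (intro eq_vecI) auto
  finally show ?thesis .
qed


section \<open>Necessity of the spectral conditions\<close>

text \<open>Let \<open>A\<^sup>2 x = s\<^sup>2 x\<close>. Since \<open>(A - s) (A + s) x = 0\<close>, either \<open>(A + s) x\<close> is an eigenvector of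
  \<open>A\<close> for \<open>s\<close>, or \<open>x\<close> is one for \<open>- s\<close>. In both cases \<open>s\<close> is real.\<close>

lemma sqrt_imp_spectrum_nonneg:
  assumes nn: "H_nonnegative n H A"
  shows "spectrum (A * A) \<subseteq> \<real>\<^sub>\<ge>\<^sub>0"
proof
  fix l assume "l \<in> spectrum (A * A)"
  have A: "A \<in> carrier_mat n n" using nn by (simp add: H_nonnegative_def)
  from \<open>l \<in> _\<close> A obtain x where x: "x \<in> carrier_vec n" "x \<noteq> 0\<^sub>v n"
    and ev: "A *\<^sub>v (A *\<^sub>v x) = l \<cdot>\<^sub>v x"
    by (auto simp: spectrum_def eigenvalue_def eigenvector_def)
  define s where "s = csqrt l"
  have s: "l = s * s" by (simp add: s_def flip: power2_eq_square)
  define y where "y = A *\<^sub>v x + s \<cdot>\<^sub>v x"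
  have y: "y \<in> carrier_vec n" using A x by (simp add: y_def)
  have "s \<in> \<real>"
  proof (cases "y = 0\<^sub>v n")
    case True
    have "A *\<^sub>v x = (- s) \<cdot>\<^sub>v x"
    proof (intro eq_vecI)
      fix i assume "i < dim_vec ((- s) \<cdot>\<^sub>v x)"
      hence i: "i < n" using x by simp
      have "y $ i = 0" using True i by simp
      thus "(A *\<^sub>v x) $ i = ((- s) \<cdot>\<^sub>v x) $ i"
        using A x i by (simp add: y_def eq_neg_iff_add_eq_0)
    qed (use A x in simp)
    from H_nonnegative_eigenvalue_real[OF nn x this] show ?thesis by simp
  next
    case False
    have "A *\<^sub>v y = A *\<^sub>v (A *\<^sub>v x) + s \<cdot>\<^sub>v (A *\<^sub>v x)"
      using A x by (simp add: y_def mult_add_distrib_mat_vec[of _ n n] mult_mat_vec[of _ n n])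
    also have "\<dots> = s \<cdot>\<^sub>v y"
      unfolding ev s using A x by (intro eq_vecI) (auto simp: y_def algebra_simps)
    finally show ?thesis by (rule H_nonnegative_eigenvalue_real[OF nn y False])
  qed
  then obtain r where "s = of_real r" by (auto elim: Reals_cases)
  thus "l \<in> \<real>\<^sub>\<ge>\<^sub>0" unfolding s by (simp add: complex_nonneg_Reals_iff)
qed

text \<open>If \<open>A\<^sup>4 x = 0\<close>, then two uses of the kernel lemma for \<open>A\<^sup>3\<close>, at \<open>A x\<close> and at \<open>x\<close>, give
  \<open>A\<^sup>2 x = 0\<close>.\<close>

lemma sqrt_imp_no_jordan_block_2:
  assumes nn: "H_nonnegative n H A"
  shows "\<not> has_jordan_block (A * A) 2 0"
proof
  have A: "A \<in> carrier_mat n n" using nn by (simp add: H_nonnegative_def)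
  hence AA: "A * A \<in> carrier_mat n n" by simp
  have C: "char_matrix (A * A) 0 \<in> carrier_mat n n" using A by simp
  have CA: "char_matrix (A * A) 0 *\<^sub>v v = A *\<^sub>v (A *\<^sub>v v)" if "v \<in> carrier_vec n" for v
    using A that by (simp add: char_matrix_0[OF AA])
  assume "has_jordan_block (A * A) 2 0"
  then obtain n_as where jnf: "jordan_nf (A * A) n_as" and mem: "(2, 0) \<in> set n_as"
    by (auto simp: has_jordan_block_def)
  have "2 \<le> Suc 0"
  proof (rule jordan_block_size_le[OF AA jnf _ mem])
    fix v assume v: "v \<in> carrier_vec n" and 0: "char_matrix (A * A) 0 ^\<^sub>m Suc (Suc 0) *\<^sub>v v = 0\<^sub>v n"
    have Av: "A *\<^sub>v v \<in> carrier_vec n" "A *\<^sub>v (A *\<^sub>v v) \<in> carrier_vec n" using A v by auto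
    note pow = pow_mat_Suc_mult_vec[OF C v] and pow0 = pow_mat_0_mult_vec[OF C v]
    have "A *\<^sub>v (A *\<^sub>v (A *\<^sub>v (A *\<^sub>v v))) = 0\<^sub>v n"
      using 0 by (simp only: pow pow0 CA v Av)
    hence "A *\<^sub>v (A *\<^sub>v (A *\<^sub>v v)) = 0\<^sub>v n" using H_nonnegative_kernel_cube[OF nn Av(1)] by simp
    hence "A *\<^sub>v (A *\<^sub>v v) = 0\<^sub>v n" using H_nonnegative_kernel_cube[OF nn v] by simp
    thus "char_matrix (A * A) 0 ^\<^sub>m Suc 0 *\<^sub>v v = 0\<^sub>v n" by (simp only: pow pow0 CA v)
  qed
  thus False by simp
qed

section \<open>Construction of the square root\<close>

text \<open>Away from \<open>0\<close> the kernels stabilize at the first power of \<open>B - a\<close>, at \<open>0\<close> possibly not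
  before the second. The gap is what the condition on blocks of size two at \<open>0\<close> closes.\<close>

lemma H_nonnegative_jordan_blocks:
  assumes nn: "H_nonnegative n H B" and jnf: "jordan_nf B n_as" and mem: "(m, a) \<in> set n_as"
    and a: "a \<in> \<real>"
  shows "a \<noteq> 0 \<Longrightarrow> m = 1" and "a = 0 \<Longrightarrow> m \<le> 2"
proof -
  have B: "B \<in> carrier_mat n n" using nn by (simp add: H_nonnegative_def)
  have C: "char_matrix B a \<in> carrier_mat n n" using B by simp
  note pow = pow_mat_Suc_mult_vec[OF C] and pow0 = pow_mat_0_mult_vec[OF C]
  have m: "m \<noteq> 0" using jnf mem by (force simp: jordan_nf_def)
  {
    assume a0: "a \<noteq> 0"
    have "m \<le> Suc 0"
    proof (rule jordan_block_size_le[OF B jnf _ mem])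
      fix v assume v: "v \<in> carrier_vec n" and 0: "char_matrix B a ^\<^sub>m Suc (Suc 0) *\<^sub>v v = 0\<^sub>v n"
      define y where "y = B *\<^sub>v v - a \<cdot>\<^sub>v v"
      have y: "y \<in> carrier_vec n" using B v by (simp add: y_def)
      have y_C: "y = char_matrix B a *\<^sub>v v" by (simp add: y_def char_matrix_mult_vec[OF B v])
      have C0: "char_matrix B a *\<^sub>v y = 0\<^sub>v n" using 0 by (simp only: pow[OF v] pow0[OF v] y_C)
      have "B *\<^sub>v y = a \<cdot>\<^sub>v y"
      proof (cases "y = 0\<^sub>v n")
        case False
        hence "eigenvector B y a" using C0 y eigenvector_char_matrix[OF B] by simp
        thus ?thesis by (simp add: eigenvector_def)
      next
        case True
        show ?thesis unfolding True using B by (intro eq_vecI) auto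
      qed
      from H_nonnegative_kernel_shift[OF nn v a a0 y_def this]
      show "char_matrix B a ^\<^sub>m Suc 0 *\<^sub>v v = 0\<^sub>v n" by (simp only: pow[OF v] pow0[OF v] y_C)
    qed
    with m show "m = 1" by simp
  next
    assume a0: "a = 0"
    have CB: "char_matrix B a *\<^sub>v v = B *\<^sub>v v" if "v \<in> carrier_vec n" for v
      by (simp add: a0 char_matrix_0[OF B])
    have "m \<le> Suc (Suc 0)"
    proof (rule jordan_block_size_le[OF B jnf _ mem])
      fix v assume v: "v \<in> carrier_vec n"
        and 0: "char_matrix B a ^\<^sub>m Suc (Suc (Suc 0)) *\<^sub>v v = 0\<^sub>v n"
      have "B *\<^sub>v v \<in> carrier_vec n" "B *\<^sub>v (B *\<^sub>v v) \<in> carrier_vec n" using B v by auto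
      thus "char_matrix B a ^\<^sub>m Suc (Suc 0) *\<^sub>v v = 0\<^sub>v n"
        using 0 H_nonnegative_kernel_cube[OF nn v] by (simp only: pow[OF v] pow0[OF v] CB v)
    qed
    thus "m \<le> 2" by simp
  }
qed

lemma H_nonnegative_diagonalizable:
  assumes nn: "H_nonnegative n H B" and spec: "spectrum B \<subseteq> \<real>\<^sub>\<ge>\<^sub>0"
    and no2: "\<not> has_jordan_block B 2 0"
  obtains P Q d where "P \<in> carrier_mat n n" "Q \<in> carrier_mat n n" "P * Q = 1\<^sub>m n" "Q * P = 1\<^sub>m n"
    and "B = P * mat_diag n d * Q" and "\<And>i. i < n \<Longrightarrow> d i \<in> \<real>\<^sub>\<ge>\<^sub>0"
proof -
  have B: "B \<in> carrier_mat n n" using nn by (simp add: H_nonnegative_def)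
  from char_poly_factorized[OF B] jordan_nf_exists[OF B] obtain n_as where jnf: "jordan_nf B n_as"
    by blast
  have ev: "a \<in> \<real>\<^sub>\<ge>\<^sub>0" and one: "m = 1" if mem: "(m, a) \<in> set n_as" for m a
  proof -
    have m: "m \<noteq> 0" using jnf mem by (force simp: jordan_nf_def)
    have "char_poly B \<noteq> 0" using degree_monic_char_poly[OF B] by auto
    from jordan_nf_block_size_order_bound[OF jnf mem] m this
    have "poly (char_poly B) a = 0" by (auto simp: order_root)
    thus a: "a \<in> \<real>\<^sub>\<ge>\<^sub>0" using spec spectrum_root_char_poly[OF B] by auto
    hence "a \<in> \<real>" by (simp add: complex_is_Real_iff complex_nonneg_Reals_iff)
    note blocks = H_nonnegative_jordan_blocks[OF nn jnf mem this]
    have "\<not> (m = 2 \<and> a = 0)" using no2 jnf mem by (auto simp: has_jordan_block_def)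
    with blocks m show "m = 1" by (cases "a = 0") auto
  qed
  let ?d = "\<lambda>i. snd (n_as ! i)"
  have J: "jordan_matrix n_as = mat_diag (length n_as) ?d"
    by (rule jordan_matrix_diagonal) (rule one)
  from jnf obtain P Q where wit: "similar_mat_wit B (jordan_matrix n_as) P Q"
    by (auto simp: jordan_nf_def similar_mat_def)
  note w = similar_mat_witD2[OF B wit]
  have "dim_row (jordan_matrix n_as) = n" using w(5) by blast
  hence len: "length n_as = n" unfolding J by (simp add: mat_diag_def)
  show thesis
  proof (rule that[of P Q ?d])
    show "?d i \<in> \<real>\<^sub>\<ge>\<^sub>0" if "i < n" for i
      using ev[of "fst (n_as ! i)" "?d i"] that len by simp
  qed (use w J len in simp_all)
qed

text \<open>A real function of a diagonalizable selfadjoint matrix with real eigenvalues is selfadjoint: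
  in a basis of eigenvectors, the Gram matrix of the form couples only vectors with the
  same eigenvalue, hence it commutes with every function of the diagonal.\<close>

lemma H_selfadjoint_function:
  assumes P: "P \<in> carrier_mat n n" and Q: "Q \<in> carrier_mat n n"
    and PQ: "P * Q = 1\<^sub>m n" and QP: "Q * P = 1\<^sub>m n"
    and sa: "H_selfadjoint n H (P * mat_diag n d * Q)"
    and d: "\<And>i. i < n \<Longrightarrow> d i \<in> \<real>" and f: "\<And>i. i < n \<Longrightarrow> f (d i) \<in> \<real>"
  shows "H_selfadjoint n H (P * mat_diag n (\<lambda>i. f (d i)) * Q)"
proof -
  (* The Gram matrix of the form in the basis of columns of P. *)
  define G where "G = mat_adjoint P * H * P"
  have P': "mat_adjoint P \<in> carrier_mat n n" using P by (intro carrier_matI) auto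
  have G: "G \<in> carrier_mat n n" using P P' H by (auto simp: G_def)
  have gram: "\<langle>P *\<^sub>v u, P *\<^sub>v v\<rangle> = (G *\<^sub>v u) \<bullet>c v"
    if u: "u \<in> carrier_vec n" and v: "v \<in> carrier_vec n" for u v
  proof -
    have inv: "mat_adjoint (mat_adjoint P) = P"
      by (intro eq_matI) auto
    have w: "H *\<^sub>v (P *\<^sub>v u) \<in> carrier_vec n" using H P u by simp
    have "(G *\<^sub>v u) \<bullet>c v = (mat_adjoint P *\<^sub>v (H *\<^sub>v (P *\<^sub>v u))) \<bullet>c v"
      using P P' H u by (simp add: G_def assoc_mult_mat_vec[of _ n n _ n])
    thus ?thesis unfolding cscalar_prod_mat_adjoint[OF P' w v] inv indef_prod_def ..
  qed
  have PDQ: "(P * mat_diag n g * Q) *\<^sub>v x = P *\<^sub>v (mat_diag n g *\<^sub>v (Q *\<^sub>v x))"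
    if "x \<in> carrier_vec n" for x and g :: "nat \<Rightarrow> complex"
    using P Q that by (simp add: assoc_mult_mat_vec[of _ n n _ n])
  have QPu: "Q *\<^sub>v (P *\<^sub>v u) = u" if "u \<in> carrier_vec n" for u
    using that assoc_mult_mat_vec[OF Q P that] by (simp add: QP)
  have PQx: "P *\<^sub>v (Q *\<^sub>v x) = x" if "x \<in> carrier_vec n" for x
    using that assoc_mult_mat_vec[OF P Q that] by (simp add: PQ)
  (* Eigenvectors for different eigenvalues are orthogonal for the form. *)
  have orth: "d i = d j \<or> G $$ (i, j) = 0" if i: "i < n" and j: "j < n" for i j
  proof -
    have unit: "mat_diag n d *\<^sub>v unit_vec n k = d k \<cdot>\<^sub>v unit_vec n k" if "k < n" for k
      using that by (subst mat_diag_mult_vec) (auto simp: unit_vec_def)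
    have ev: "(P * mat_diag n d * Q) *\<^sub>v (P *\<^sub>v unit_vec n k) = d k \<cdot>\<^sub>v (P *\<^sub>v unit_vec n k)"
      if "k < n" for k
      using P that by (simp add: PDQ QPu unit mult_mat_vec[of _ n n])
    have "d j * \<langle>P *\<^sub>v unit_vec n j, P *\<^sub>v unit_vec n i\<rangle>
        = cnj (d i) * \<langle>P *\<^sub>v unit_vec n j, P *\<^sub>v unit_vec n i\<rangle>"
      using sa[unfolded H_selfadjoint_def, THEN conjunct2, rule_format,
          of "P *\<^sub>v unit_vec n j" "P *\<^sub>v unit_vec n i"] P
      unfolding ev[OF i] ev[OF j] by (simp add: ip_smult_left ip_smult_right)
    moreover have "\<langle>P *\<^sub>v unit_vec n j, P *\<^sub>v unit_vec n i\<rangle> = G $$ (i, j)"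
    proof -
      have "conjugate (unit_vec n i) = (unit_vec n i :: complex vec)"
        by (intro eq_vecI) (auto simp: unit_vec_def)
      thus ?thesis using G i j by (subst gram) auto
    qed
    ultimately show ?thesis using d[OF i] by (auto simp: Reals_cnj_iff)
  qed
  (* Nonzero entries of G occur only where d i = d j, and there the factors f (d j) and f (d i)
     coincide. *)
  have move: "(G *\<^sub>v (mat_diag n (\<lambda>i. f (d i)) *\<^sub>v u)) \<bullet>c v = (G *\<^sub>v u) \<bullet>c (mat_diag n (\<lambda>i. f (d i)) *\<^sub>v v)"
    if u: "u \<in> carrier_vec n" and v: "v \<in> carrier_vec n" for u v
  proof -
    have "(G *\<^sub>v (mat_diag n (\<lambda>i. f (d i)) *\<^sub>v u)) \<bullet>c v
        = (\<Sum>i<n. (\<Sum>j<n. G $$ (i, j) * (f (d j) * u $ j)) * cnj (v $ i))"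
      unfolding mat_diag_mult_vec[OF u] using G u v
      by (auto simp: scalar_prod_def atLeast0LessThan intro!: sum.cong)
    also have "\<dots> = (\<Sum>i<n. (\<Sum>j<n. G $$ (i, j) * u $ j) * cnj (f (d i) * v $ i))"
      unfolding sum_distrib_right
    proof (intro sum.cong refl)
      fix i j assume "i \<in> {..<n}" "j \<in> {..<n}"
      thus "G $$ (i, j) * (f (d j) * u $ j) * cnj (v $ i)
          = G $$ (i, j) * u $ j * cnj (f (d i) * v $ i)"
        using orth[of i j] f[of i] by (auto simp: Reals_cnj_iff)
    qed
    also have "\<dots> = (G *\<^sub>v u) \<bullet>c (mat_diag n (\<lambda>i. f (d i)) *\<^sub>v v)"
      unfolding mat_diag_mult_vec[OF v] using G u v
      by (auto simp: scalar_prod_def atLeast0LessThan intro!: sum.cong)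
    finally show ?thesis .
  qed
  let ?F = "mat_diag n (\<lambda>i. f (d i))"
  have F: "?F \<in> carrier_mat n n" by simp
  have "\<langle>(P * ?F * Q) *\<^sub>v x, y\<rangle> = \<langle>x, (P * ?F * Q) *\<^sub>v y\<rangle>"
    if x: "x \<in> carrier_vec n" and y: "y \<in> carrier_vec n" for x y
  proof -
    have u: "Q *\<^sub>v x \<in> carrier_vec n" and v: "Q *\<^sub>v y \<in> carrier_vec n" using Q x y by auto
    have "\<langle>(P * ?F * Q) *\<^sub>v x, y\<rangle> = \<langle>P *\<^sub>v (?F *\<^sub>v (Q *\<^sub>v x)), P *\<^sub>v (Q *\<^sub>v y)\<rangle>"
      by (simp only: PDQ[OF x] PQx[OF y])
    also have "\<dots> = \<langle>P *\<^sub>v (Q *\<^sub>v x), P *\<^sub>v (?F *\<^sub>v (Q *\<^sub>v y))\<rangle>"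
      using gram[OF mult_mat_vec_carrier[OF F u] v] gram[OF u mult_mat_vec_carrier[OF F v]]
        move[OF u v] by simp
    also have "\<dots> = \<langle>x, (P * ?F * Q) *\<^sub>v y\<rangle>"
      by (simp only: PDQ[OF y] PQx[OF x])
    finally show ?thesis .
  qed
  thus ?thesis using mult_carrier_mat[OF mult_carrier_mat[OF P F] Q] by (simp add: H_selfadjoint_def)
qed

text \<open>The root is obtained as \<open>A = W B W\<close>, because nonnegativity passes from \<open>B\<close> to \<open>W B W\<close> for
  every selfadjoint \<open>W\<close>, and the eigenvalues match since \<open>z\<^bsup>-1/4\<^esup> z z\<^bsup>-1/4\<^esup> = z\<^bsup>1/2\<^esup>\<close>.\<close>

lemma sqrt_exists:
  assumes nn: "H_nonnegative n H B" and spec: "spectrum B \<subseteq> \<real>\<^sub>\<ge>\<^sub>0"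
    and no2: "\<not> has_jordan_block B 2 0"
  shows "\<exists>A. H_nonnegative_sqrt n H B A"
proof -
  from H_nonnegative_diagonalizable[OF assms] obtain P Q d where
    P: "P \<in> carrier_mat n n" and Q: "Q \<in> carrier_mat n n" and PQ: "P * Q = 1\<^sub>m n" and QP: "Q * P = 1\<^sub>m n"
    and B_eq: "B = P * mat_diag n d * Q" and d: "\<And>i. i < n \<Longrightarrow> d i \<in> \<real>\<^sub>\<ge>\<^sub>0" by blast
  have B: "B \<in> carrier_mat n n" using nn by (simp add: H_nonnegative_def)
  have mult: "(P * mat_diag n f * Q) * (P * mat_diag n g * Q) = P * mat_diag n (\<lambda>i. f i * g i) * Q"
    for f g :: "nat \<Rightarrow> complex"
  proof -
    note carrier = mult_carrier_mat[of _ n n _ n] mat_diag_dim[of n]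
    note assoc = assoc_mult_mat[of _ n n _ n _ n]
    have cancel: "Q * (P * X) = X" if "X \<in> carrier_mat n n" for X
      using that assoc_mult_mat[OF Q P that] by (simp add: QP)
    have "(P * mat_diag n f * Q) * (P * mat_diag n g * Q)
        = P * (mat_diag n f * (mat_diag n g * Q))"
      using P Q by (simp add: assoc carrier cancel)
    also have "\<dots> = P * (mat_diag n f * mat_diag n g) * Q"
      using P Q by (simp add: assoc carrier del: mat_diag_diag)
    finally show ?thesis by simp
  qed
  have diag_cong: "mat_diag n f = mat_diag n g" if "\<And>i. i < n \<Longrightarrow> f i = g i" for f g :: "nat \<Rightarrow> complex"
    using that by (auto simp: mat_diag_def)
  (* Division by zero yields 0, so e 0 = 0, and e z * z * e z is the root of z also at z = 0. *)
  define e :: "complex \<Rightarrow> complex" where "e z = of_real (1 / sqrt (sqrt (Re z)))" for z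
  define W where "W = P * mat_diag n (\<lambda>i. e (d i)) * Q"
  have dR: "d i = of_real (Re (d i))" "Re (d i) \<ge> 0" if "i < n" for i
    using d[OF that] by (auto simp: complex_nonneg_Reals_iff complex_eq_iff)
  have W_sa: "H_selfadjoint n H W" unfolding W_def
  proof (rule H_selfadjoint_function[OF P Q PQ QP, of d e])
    show "H_selfadjoint n H (P * mat_diag n d * Q)"
      using H_nonnegative_selfadjoint[OF nn] B_eq by simp
    show "d i \<in> \<real>" if "i < n" for i using dR(1)[OF that] by (metis Reals_of_real)
  qed (simp add: e_def)
  have W: "W \<in> carrier_mat n n" using W_sa by (simp add: H_selfadjoint_def)
  define A where "A = W * B * W"
  have A: "A \<in> carrier_mat n n" using W B by (simp add: A_def)
  have A_eq: "A = P * mat_diag n (\<lambda>i. of_real (sqrt (Re (d i)))) * Q"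
  proof -
    have "e (d i) * d i * e (d i) = of_real (sqrt (Re (d i)))" if "i < n" for i
    proof -
      define r where "r = Re (d i)"
      have di: "d i = of_real r" and r: "r \<ge> 0" using dR[OF that] by (simp_all add: r_def)
      have "1 / sqrt (sqrt r) * r * (1 / sqrt (sqrt r)) = r / sqrt r" using r by simp
      also have "\<dots> = sqrt r" using r by (simp add: real_div_sqrt)
      finally show ?thesis unfolding e_def di by (simp only: Re_complex_of_real flip: of_real_mult)
    qed
    thus ?thesis unfolding A_def W_def B_eq mult by (simp cong: diag_cong)
  qed
  have "A * A = B"
  proof -
    have "complex_of_real (sqrt (Re (d i))) * of_real (sqrt (Re (d i))) = d i" if "i < n" for i
      using dR[OF that] by (simp flip: of_real_mult)
    thus ?thesis unfolding A_eq mult B_eq by (simp cong: diag_cong)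
  qed
  moreover have "0 \<le> \<langle>A *\<^sub>v x, x\<rangle>" if x: "x \<in> carrier_vec n" for x
  proof -
    have Wx: "W *\<^sub>v x \<in> carrier_vec n" and BWx: "B *\<^sub>v (W *\<^sub>v x) \<in> carrier_vec n" using W B x by auto
    have "\<langle>A *\<^sub>v x, x\<rangle> = \<langle>W *\<^sub>v (B *\<^sub>v (W *\<^sub>v x)), x\<rangle>"
      using W B x by (simp add: A_def assoc_mult_mat_vec[of _ n n _ n])
    also have "\<dots> = \<langle>B *\<^sub>v (W *\<^sub>v x), W *\<^sub>v x\<rangle>"
      using W_sa BWx x by (simp add: H_selfadjoint_def)
    finally show ?thesis using nn Wx by (simp add: H_nonnegative_def)
  qed
  ultimately show ?thesis using A by (auto simp: H_nonnegative_sqrt_def H_nonnegative_def)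
qed

end

theorem theorem5p1:
  fixes n :: nat and H B :: "complex mat"
  assumes "H \<in> carrier_mat n n"
    and "invertible_mat H"
    and "hermitian_mat H"
    and "H_nonnegative n H B"
  shows "(\<exists>A. H_nonnegative_sqrt n H B A) \<longleftrightarrow>
         spectrum B \<subseteq> \<real>\<^sub>\<ge>\<^sub>0 \<and> \<not> has_jordan_block B 2 0"
proof -
  interpret indefinite_space n H using assms(1-3) by unfold_locales
  show ?thesis
    using sqrt_imp_spectrum_nonneg sqrt_imp_no_jordan_block_2 sqrt_exists[OF assms(4)]
    by (auto simp: H_nonnegative_sqrt_def)
qed

end
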